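(* If $G$ and $H$ are two connected bipartite graphs and $G\Box H\neq K_2$, then $\mu(G\Box H)\leq 2$.
   Context: All graphs are finite and simple, and vertex-coloring edge-weightings are considered for connected graphs with at least three vertices. A $k$-edge-weighting of a graph $G$ is a function $w:E(G)\to\{1,2,\ldots,k\}$. It induces a vertex coloring $c$ by $c(v)=\sum_{e\sim v}w(e)$, where $e\sim v$ means that $e$ is an edge incident to $v$. If $c$ is a proper vertex coloring ($c(u)\neq c(v)$ for every two adjacent vertices $u,v$), then $w$ is called a vertex-coloring $k$-edge-weighting (VC$k$-EW). $\mu(G)$ denotes the minimum $k$ for which $G$ has a VC$k$-EW. $K_2$ is the complete graph on two vertices. The Cartesian product $G\Box H$ has vertex set $V(G)\times V(H)$, with $(u,v)$ adjacent to $(u',v')$ if and only if $u=u'$ and $vv'\in E(H)$, or $v=v'$ and $uu'\in E(G)$.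
   Formalization: Both G and H are assumed to have at least two vertices; with a one-vertex factor the claim fails, since K_1 □ C_6 is C_6, which is connected and bipartite, differs from K_2, and has μ(C_6)=3. *)

theory Defs
  imports "Graph_Theory.Graph_Theory" "HOL-Library.Extended_Nat"
begin

text \<open>
  A finite simple graph is a \<^locale>\<open>pair_graph\<close>: an undirected edge between \<open>u\<close> and \<open>v\<close> is
  represented by the two arcs \<open>(u, v)\<close> and \<open>(v, u)\<close>. Weights are attached to the edges
  \<open>{u, v}\<close>, so that both arcs of an edge share one weight.
\<close>

definition uedges :: "'a pair_pre_digraph \<Rightarrow> 'a set set" where
  "uedges G = {{u, v} | u v. (u, v) \<in> parcs G}"

definition bipartite :: "'a pair_pre_digraph \<Rightarrow> bool" where
  "bipartite G \<longleftrightarrow> (\<exists>A B. A \<union> B = pverts G \<and> A \<inter> B = {} \<and>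
     (\<forall>(u, v) \<in> parcs G. (u \<in> A \<and> v \<in> B) \<or> (u \<in> B \<and> v \<in> A)))"

definition cartesian_product ::
    "'a pair_pre_digraph \<Rightarrow> 'b pair_pre_digraph \<Rightarrow> ('a \<times> 'b) pair_pre_digraph"
    (infixl \<open>\<box>\<close> 70) where
  "G \<box> H = \<lparr> pverts = pverts G \<times> pverts H,
     parcs = {((u, v), (u', v')) | u v u' v'.
       (u = u' \<and> u \<in> pverts G \<and> (v, v') \<in> parcs H) \<or>
       (v = v' \<and> v \<in> pverts H \<and> (u, u') \<in> parcs G)} \<rparr>"

definition edge_weighting :: "nat \<Rightarrow> 'a pair_pre_digraph \<Rightarrow> ('a set \<Rightarrow> nat) \<Rightarrow> bool" where
  "edge_weighting k G w \<longleftrightarrow> (\<forall>e \<in> uedges G. w e \<in> {1..k})"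

definition induced_colouring :: "'a pair_pre_digraph \<Rightarrow> ('a set \<Rightarrow> nat) \<Rightarrow> 'a \<Rightarrow> nat" where
  "induced_colouring G w v = (\<Sum>e \<in> {e \<in> uedges G. v \<in> e}. w e)"

definition proper_colouring :: "'a pair_pre_digraph \<Rightarrow> ('a \<Rightarrow> 'c) \<Rightarrow> bool" where
  "proper_colouring G c \<longleftrightarrow> (\<forall>(u, v) \<in> parcs G. c u \<noteq> c v)"

definition vc_edge_weighting :: "nat \<Rightarrow> 'a pair_pre_digraph \<Rightarrow> ('a set \<Rightarrow> nat) \<Rightarrow> bool" where
  "vc_edge_weighting k G w \<longleftrightarrow>
     edge_weighting k G w \<and> proper_colouring G (induced_colouring G w)"

text \<open>
  The infimum is a minimum whenever some vertex-colouring edge-weighting exists, and \<open>\<infinity>\<close>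
  otherwise (for instance for \<open>K\<^sub>2\<close>).
\<close>

definition mu :: "'a pair_pre_digraph \<Rightarrow> enat" (\<open>\<mu>\<close>) where
  "\<mu> G = Inf {enat k | k. k \<ge> 1 \<and> (\<exists>w. vc_edge_weighting k G w)}"

lemma pair_graph_cartesian_product:
  assumes "pair_graph G" "pair_graph H"
  shows "pair_graph (G \<box> H)"
proof -
  interpret G: pair_graph G by fact
  interpret H: pair_graph H by fact
  have sub: "parcs (G \<box> H) \<subseteq> (pverts G \<times> pverts H) \<times> (pverts G \<times> pverts H)"
    by (auto simp: cartesian_product_def dest: G.in_arcsD1 G.in_arcsD2 H.in_arcsD1 H.in_arcsD2)
  have fin: "finite (pverts G \<times> pverts H)"
    using G.pair_finite_verts H.pair_finite_verts by simp
  have "sym (parcs G)" "sym (parcs H)"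
    using G.pair_sym_arcs H.pair_sym_arcs by (auto simp: symmetric_def)
  then have "symmetric (G \<box> H)"
    unfolding symmetric_def sym_def cartesian_product_def by auto
  moreover have "fst e \<noteq> snd e" if "e \<in> parcs (G \<box> H)" for e
    using that G.pair_no_loops H.pair_no_loops by (fastforce simp: cartesian_product_def)
  moreover have "finite (parcs (G \<box> H))"
    using sub fin by (meson finite_SigmaI finite_subset)
  moreover have "pverts (G \<box> H) = pverts G \<times> pverts H"
    by (simp add: cartesian_product_def)
  ultimately show ?thesis
    using sub fin by unfold_locales auto
qed

end

theory Submission
  imports Defs
begin

text \<open>
  Let \<open>P = G \<box> H\<close>, a connected bipartite graph with parts \<open>U\<close> and \<open>W\<close>. With weights \<open>1\<close> and \<open>2\<close>,
  replacing \<open>w e\<close> by \<open>3 - w e\<close> along a walk changes the parity of the colour at the two ends of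
  the walk and nowhere else. Hence the parities of the colours can be prescribed freely on any
  vertex set that is linked by the edges allowed to change, subject only to the handshake
  condition that the number of odd colours is even (\<open>prescribed_parities\<close>).

  If \<open>U\<close> or \<open>W\<close> has even size, its vertices can be made odd and all others even, which already
  separates adjacent vertices. If both parts are odd, this fails for parity reasons, and exactly
  one vertex \<open>u\<close> of one part, say of \<open>U\<close>, is given the wrong parity (\<open>one_exceptional_vertex\<close>). All edges at \<open>u\<close>
  get weight \<open>2\<close>, so that \<open>u\<close> has colour \<open>2 deg u\<close>, and it remains to keep the neighbours of
  \<open>u\<close> away from this value.

  If both factors have at least three vertices, take \<open>u = (g, h)\<close> with \<open>g\<close> and \<open>h\<close> of maximum
  degree. Without the edges of the row \<open>G \<times> {h}\<close> and the column \<open>{g} \<times> H\<close> the graph \<open>P - u\<close> is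
  still linked, so these edges may keep weight \<open>1\<close> away from \<open>u\<close>. A neighbour of \<open>u\<close> then meets
  an edge of weight \<open>1\<close> or has smaller degree than \<open>u\<close>; either way its colour is below \<open>2 deg u\<close>
  (\<open>product_weighting_ge_3\<close>).

  If one factor is a single edge \<open>pq\<close>, the row argument gives nothing for the neighbour \<open>(q, h)\<close>
  of \<open>u = (p, h)\<close>. Here \<open>h\<close> is chosen together with a neighbour \<open>k\<close> such that either \<open>k\<close> is a leaf
  or the edge \<open>hk\<close> can be removed without disconnecting the other factor. In the first case parity
  forces weight \<open>1\<close> on the edge between \<open>(q, h)\<close> and \<open>(q, k)\<close>, in the second case the edge can be
  fixed to weight \<open>1\<close>. The neighbours in the layer of \<open>p\<close> are handled by the weights of their
  other edges in that layer, which are free (\<open>prism_weighting\<close>). The remaining product of two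
  single edges has parts of size \<open>2\<close>.
\<close>

section \<open>Neighbourhoods, induced colours and links\<close>

definition nbrs :: "'a pair_pre_digraph \<Rightarrow> 'a \<Rightarrow> 'a set" where
  "nbrs G v = {y. (v, y) \<in> parcs G}"

abbreviation deg :: "'a pair_pre_digraph \<Rightarrow> 'a \<Rightarrow> nat" where
  "deg G v \<equiv> card (nbrs G v)"

text \<open>
  Walks along edges of \<open>F\<close> are allowed to leave \<open>S\<close>: an inner vertex of a walk meets two of its
  edges per visit, so that changing them keeps its parity, wherever the vertex lies.
\<close>

definition links :: "'a set set \<Rightarrow> 'a set \<Rightarrow> bool" where
  "links F S \<longleftrightarrow> (\<forall>x\<in>S. \<forall>y\<in>S. (x, y) \<in> {(a, b). {a, b} \<in> F}\<^sup>*)"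

text \<open>
  For a symmetric arc set the equivalence also gives \<open>x \<in> W \<longleftrightarrow> y \<in> U\<close>, by reversing the arc.
\<close>

definition splits :: "'a pair_pre_digraph \<Rightarrow> 'a set \<Rightarrow> 'a set \<Rightarrow> bool" where
  "splits G U W \<longleftrightarrow> U \<union> W = pverts G \<and> U \<inter> W = {} \<and>
     (\<forall>x y. (x, y) \<in> parcs G \<longrightarrow> x \<in> U \<longleftrightarrow> y \<in> W)"

lemma bipartite_splits: "bipartite G \<longleftrightarrow> (\<exists>U W. splits G U W)"
  if "pair_graph G"
proof -
  interpret pair_graph G by fact
  show ?thesis
    unfolding bipartite_def splits_def
    by (intro ex_cong1) (auto dest: in_arcsD1 in_arcsD2, (blast dest: in_arcsD1 in_arcsD2)+)
qed

lemma links_sym: "(x, y) \<in> {(a, b). {a, b} \<in> F}\<^sup>* \<Longrightarrow> (y, x) \<in> {(a, b). {a, b} \<in> F}\<^sup>*"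
  by (rule symD[OF sym_rtrancl]) (auto simp: sym_def insert_commute)

lemma links_hub:
  assumes "\<And>x. x \<in> S \<Longrightarrow> (x, r) \<in> {(a, b). {a, b} \<in> F}\<^sup>*"
  shows "links F S"
  unfolding links_def
proof (intro ballI)
  fix x y assume "x \<in> S" "y \<in> S"
  show "(x, y) \<in> {(a, b). {a, b} \<in> F}\<^sup>*"
    by (rule rtrancl_trans[OF assms[OF \<open>x \<in> S\<close>] links_sym[OF assms[OF \<open>y \<in> S\<close>]]])
qed

context pair_graph
begin

lemma arc_sym: "(x, y) \<in> parcs G \<longleftrightarrow> (y, x) \<in> parcs G"
  using pair_sym_arcs by (auto simp: symmetric_def dest: symD)

lemma uedges_iff: "{x, y} \<in> uedges G \<longleftrightarrow> (x, y) \<in> parcs G"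
  unfolding uedges_def by (auto simp: doubleton_eq_iff arc_sym)

lemma finite_uedges: "finite (uedges G)"
  by (rule finite_subset[of _ "(\<lambda>(x, y). {x, y}) ` parcs G"])
     (auto simp: uedges_def pair_finite_arcs)

lemma finite_nbrs: "finite (nbrs G v)"
  by (rule finite_subset[OF _ pair_finite_verts]) (auto simp: nbrs_def dest: in_arcsD2)

lemma induced_colouring_nbrs: "induced_colouring G w v = (\<Sum>y\<in>nbrs G v. w {v, y})"
proof -
  have "{e \<in> uedges G. v \<in> e} = (\<lambda>y. {v, y}) ` nbrs G v"
    unfolding uedges_def nbrs_def by (auto simp: arc_sym)
  moreover have "inj_on (\<lambda>y. {v, y}) (nbrs G v)"
    by (auto simp: inj_on_def doubleton_eq_iff)
  ultimately show ?thesis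
    by (simp add: induced_colouring_def sum.reindex)
qed

lemma connected_links: "connected G \<Longrightarrow> links (uedges G) (pverts G)"
proof -
  assume "connected G"
  then have "strongly_connected G"
    using symmetric_connected_imp_strongly_connected pair_sym_arcs by blast
  then have "(x, y) \<in> (parcs G)\<^sup>*" if "x \<in> pverts G" "y \<in> pverts G" for x y
    using that reachable_rtranclI[of "with_proj G" x y] by (auto simp: strongly_connected_def)
  then show ?thesis
    by (simp add: links_def uedges_iff)
qed

section \<open>Prescribing the parity of the colours\<close>

definition toggle :: "('a set \<Rightarrow> nat) \<Rightarrow> 'a set \<Rightarrow> 'a set \<Rightarrow> nat" where
  "toggle w e = w(e := 3 - w e)"

lemma odd_toggle:
  assumes "edge_weighting 2 G w" "e \<in> uedges G"
  shows "odd (induced_colouring G (toggle w e) v) \<longleftrightarrow> odd (induced_colouring G w v) \<noteq> (v \<in> e)"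
proof (cases "v \<in> e")
  case True
  let ?E = "{e \<in> uedges G. v \<in> e}"
  have fin: "finite ?E" and e: "e \<in> ?E"
    using finite_uedges True assms by auto
  have "w e \<in> {1..2}"
    using assms by (auto simp: edge_weighting_def)
  then have "w e = 1 \<or> w e = 2" by auto
  moreover have "induced_colouring G (toggle w e) v = (3 - w e) + (\<Sum>f\<in>?E - {e}. w f)"
    unfolding induced_colouring_def toggle_def sum.remove[OF fin e] by simp
  moreover have "induced_colouring G w v = w e + (\<Sum>f\<in>?E - {e}. w f)"
    unfolding induced_colouring_def sum.remove[OF fin e] by simp
  ultimately show ?thesis using True by auto
next
  case False
  then have "induced_colouring G (toggle w e) v = induced_colouring G w v"
    unfolding induced_colouring_def toggle_def by (intro sum.cong) auto
  with False show ?thesis by simp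
qed

lemma toggle_walk:
  assumes "(x, y) \<in> {(a, b). {a, b} \<in> F}\<^sup>*" "F \<subseteq> uedges G" "edge_weighting 2 G w"
  shows "\<exists>w'. edge_weighting 2 G w' \<and> (\<forall>e. e \<notin> F \<longrightarrow> w' e = w e) \<and>
    (\<forall>v. odd (induced_colouring G w' v) \<longleftrightarrow> odd (induced_colouring G w v) \<noteq> ((v = x) \<noteq> (v = y)))"
  using assms(1)
proof induction
  case base
  then show ?case using assms(3) by blast
next
  case (step y z)
  then obtain w' where w': "edge_weighting 2 G w'" "\<forall>e. e \<notin> F \<longrightarrow> w' e = w e"
    "\<forall>v. odd (induced_colouring G w' v) \<longleftrightarrow> odd (induced_colouring G w v) \<noteq> ((v = x) \<noteq> (v = y))"
    by blast
  have e: "{y, z} \<in> F" "{y, z} \<in> uedges G" using step assms by auto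
  then have "y \<noteq> z" using uedges_iff pair_no_loops by fastforce
  moreover have "edge_weighting 2 G (toggle w' {y, z})"
    using w'(1) e unfolding edge_weighting_def toggle_def by fastforce
  moreover have "\<forall>f. f \<notin> F \<longrightarrow> toggle w' {y, z} f = w f"
    using w'(2) e by (auto simp: toggle_def)
  moreover have "odd (induced_colouring G (toggle w' {y, z}) v) \<longleftrightarrow>
      odd (induced_colouring G w v) \<noteq> ((v = x) \<noteq> (v = z))" for v
    unfolding odd_toggle[OF w'(1) e(2)] using w'(3) \<open>y \<noteq> z\<close> by auto
  ultimately show ?case by blast
qed

text \<open>
  The handshake lemma: every edge contributes its weight to the colours of both ends, so the sum
  of all colours is even.
\<close>

lemma even_card_odd_colours: "even (card {v \<in> pverts G. odd (induced_colouring G w v)})"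
proof -
  have "(\<Sum>v\<in>pverts G. induced_colouring G w v) = (\<Sum>e\<in>uedges G. \<Sum>v | v \<in> pverts G \<and> v \<in> e. w e)"
    unfolding induced_colouring_def
    by (rule sum.swap_restrict) (auto simp: pair_finite_verts finite_uedges)
  also have "\<dots> = (\<Sum>e\<in>uedges G. 2 * w e)"
  proof (rule sum.cong)
    fix e assume "e \<in> uedges G"
    then obtain x y where e: "e = {x, y}" "(x, y) \<in> parcs G" by (auto simp: uedges_def)
    then have "{v. v \<in> pverts G \<and> v \<in> e} = {x, y}" "x \<noteq> y"
      using pair_no_loops[of "(x, y)"] by (auto dest: in_arcsD1 in_arcsD2)
    then show "(\<Sum>v | v \<in> pverts G \<and> v \<in> e. w e) = 2 * w e" by simp
  qed simp
  finally have "even (\<Sum>v\<in>pverts G. induced_colouring G w v)"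
    by (simp add: sum_distrib_left[symmetric])
  then show ?thesis
    by (simp add: even_sum_iff pair_finite_verts)
qed

text \<open>
  This is the existence of \<open>T\<close>-joins in a connected graph. The vertices of wrong parity all lie in
  \<open>S\<close>, and their number is even because both \<open>T\<close> and, by the handshake lemma, the set of odd
  vertices are even. A walk in \<open>F\<close> between two of them repairs both.
\<close>

lemma prescribed_parities:
  assumes "edge_weighting 2 G w" "F \<subseteq> uedges G" "links F S"
    and "T \<subseteq> pverts G" "even (card T)"
    and "\<And>v. v \<in> pverts G - S \<Longrightarrow> odd (induced_colouring G w v) \<longleftrightarrow> v \<in> T"
  shows "\<exists>w'. edge_weighting 2 G w' \<and> (\<forall>e. e \<notin> F \<longrightarrow> w' e = w e) \<and>
    (\<forall>v\<in>pverts G. odd (induced_colouring G w' v) \<longleftrightarrow> v \<in> T)"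
  using assms(1,6)
proof (induction "card {v \<in> pverts G. odd (induced_colouring G w v) \<longleftrightarrow> v \<notin> T}" arbitrary: w
    rule: less_induct)
  case less
  define D where "D w = {v \<in> pverts G. odd (induced_colouring G w v) \<longleftrightarrow> v \<notin> T}" for w
  define O' where "O' = {v \<in> pverts G. odd (induced_colouring G w v)}"
  have fin: "finite (D w)" for w by (simp add: D_def pair_finite_verts)
  have sub: "D w \<subseteq> S" using less.prems(2) by (auto simp: D_def)
  show ?case
  proof (cases "D w = {}")
    case True
    then show ?thesis using less.prems by (intro exI[of _ w]) (auto simp: D_def)
  next
    case False
    have "finite O'" "finite T"
      using pair_finite_verts finite_subset[OF assms(4)] by (simp_all add: O'_def)
    moreover have Dw: "D w = (O' - T) \<union> (T - O')"
      using assms(4) by (auto simp: D_def O'_def)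
    moreover have "card O' = card (O' - T) + card (O' \<inter> T)" "card T = card (T - O') + card (O' \<inter> T)"
      using \<open>finite O'\<close> \<open>finite T\<close> by (metis add.commute card_Int_Diff inf_commute)+
    ultimately have "card (D w) + 2 * card (O' \<inter> T) = card O' + card T"
      by (subst Dw, subst card_Un_disjoint) auto
    moreover have "even (card O')" unfolding O'_def by (rule even_card_odd_colours)
    ultimately have "even (card (D w))"
      using assms(5) by (metis dvd_add_left_iff dvd_add_right_iff dvd_triv_left)
    with False fin have "card (D w) \<ge> 2"
      by (metis card_0_eq dvd_imp_le neq0_conv)
    then obtain x y where xy: "x \<in> D w" "y \<in> D w" "x \<noteq> y"
      by (metis card_2_iff' obtain_subset_with_card_n subset_iff)
    with sub have "(x, y) \<in> {(a, b). {a, b} \<in> F}\<^sup>*"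
      using assms(3) by (auto simp: links_def)
    from toggle_walk[OF this assms(2) less.prems(1)] obtain w' where
      w': "edge_weighting 2 G w'" "\<forall>e. e \<notin> F \<longrightarrow> w' e = w e"
      "\<forall>v. odd (induced_colouring G w' v) \<longleftrightarrow> odd (induced_colouring G w v) \<noteq> ((v = x) \<noteq> (v = y))"
      by blast
    have D': "D w' = D w - {x, y}"
      using xy w'(3) by (auto simp: D_def)
    then have lt: "card (D w') < card (D w)"
      using xy fin by (intro psubset_card_mono) auto
    have "odd (induced_colouring G w' v) \<longleftrightarrow> v \<in> T" if "v \<in> pverts G - S" for v
      using that less.prems(2)[OF that] w'(3) xy sub by auto
    from less.hyps[OF lt[unfolded D_def] w'(1) this] show ?thesis
      using w'(2) by metis
  qed
qed

lemma splits_sym: "splits G U W \<Longrightarrow> splits G W U"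
  unfolding splits_def using arc_sym by blast

lemma vc_edge_weighting_even_part:
  assumes "splits G U W" "even (card U)" "links (uedges G) (pverts G)"
  shows "\<exists>w. vc_edge_weighting 2 G w"
proof -
  have "edge_weighting 2 G (\<lambda>_. 1)" by (simp add: edge_weighting_def)
  moreover have "U \<subseteq> pverts G" using assms(1) by (auto simp: splits_def)
  ultimately obtain w where w: "edge_weighting 2 G w"
      "\<forall>v\<in>pverts G. odd (induced_colouring G w v) \<longleftrightarrow> v \<in> U"
    using prescribed_parities[of "\<lambda>_. 1" "uedges G" "pverts G" U] assms(2,3)
    by auto
  have "induced_colouring G w x \<noteq> induced_colouring G w y" if "(x, y) \<in> parcs G" for x y
  proof -
    have "x \<in> pverts G" "y \<in> pverts G" using that by (auto dest: in_arcsD1 in_arcsD2)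
    moreover have "x \<in> U \<longleftrightarrow> y \<notin> U" using assms(1) that calculation by (auto simp: splits_def)
    ultimately show ?thesis using w(2) by metis
  qed
  then show ?thesis using w(1) by (auto simp: vc_edge_weighting_def proper_colouring_def)
qed

lemma weight_1_or_2: "edge_weighting 2 G w \<Longrightarrow> y \<in> nbrs G v \<Longrightarrow> w {v, y} = 1 \<or> w {v, y} = 2"
  using uedges_iff[of v y] by (fastforce simp: edge_weighting_def nbrs_def)

lemma induced_colouring_le:
  assumes "edge_weighting 2 G w"
  shows "induced_colouring G w v \<le> 2 * deg G v"
  unfolding induced_colouring_nbrs
  using sum_bounded_above[of "nbrs G v" "\<lambda>y. w {v, y}" 2] weight_1_or_2[OF assms] by force

lemma induced_colouring_less:
  assumes "edge_weighting 2 G w" "y \<in> nbrs G v" "w {v, y} = 1"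
  shows "induced_colouring G w v < 2 * deg G v"
proof -
  have "(\<Sum>y\<in>nbrs G v. w {v, y}) < (\<Sum>y\<in>nbrs G v. 2)"
    using assms weight_1_or_2[OF assms(1)]
    by (intro sum_strict_mono_ex1) (force simp: finite_nbrs)+
  then show ?thesis by (simp add: induced_colouring_nbrs)
qed

text \<open>
  Only the edges at \<open>u\<close> join vertices of equal parity. The colour of \<open>u\<close> is known exactly, since
  all its edges keep weight \<open>2\<close>. The edges outside \<open>F\<close> keep prescribed weights, which is what the applications
  use to exclude the value \<open>2 * deg G u\<close> at the neighbours.
\<close>

lemma one_exceptional_vertex:
  assumes "splits G U W" "odd (card U)" "u \<in> U"
    and F: "F \<subseteq> uedges G" "\<And>e. e \<in> F \<Longrightarrow> u \<notin> e" "links F (pverts G - {u})"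
    and w0: "edge_weighting 2 G w0" "\<And>y. y \<in> nbrs G u \<Longrightarrow> w0 {u, y} = 2"
  obtains w where "edge_weighting 2 G w" "\<And>e. e \<notin> F \<Longrightarrow> w e = w0 e"
    "\<And>v. v \<in> pverts G \<Longrightarrow> odd (induced_colouring G w v) \<longleftrightarrow> v \<in> U - {u}"
    "\<forall>x\<in>nbrs G u. induced_colouring G w x \<noteq> 2 * deg G u \<Longrightarrow> vc_edge_weighting 2 G w"
proof -
  have U: "U \<subseteq> pverts G" using assms(1) by (auto simp: splits_def)
  have cu: "induced_colouring G w u = 2 * deg G u" if "\<And>e. e \<notin> F \<Longrightarrow> w e = w0 e" for w
  proof -
    have "w {u, y} = 2" if "y \<in> nbrs G u" for y
      using w0(2)[OF that] F(2) \<open>\<And>e. e \<notin> F \<Longrightarrow> w e = w0 e\<close> by (metis insertI1)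
    then show ?thesis by (simp add: induced_colouring_nbrs)
  qed
  have "even (card (U - {u}))"
    using assms(2,3) finite_subset[OF U pair_finite_verts] by (simp add: card_Diff_singleton)
  moreover have "U - {u} \<subseteq> pverts G" using U by auto
  moreover have "odd (induced_colouring G w0 v) \<longleftrightarrow> v \<in> U - {u}"
    if "v \<in> pverts G - (pverts G - {u})" for v
    using that cu[of w0] by auto
  ultimately obtain w where w: "edge_weighting 2 G w" "\<And>e. e \<notin> F \<Longrightarrow> w e = w0 e"
    "\<And>v. v \<in> pverts G \<Longrightarrow> odd (induced_colouring G w v) \<longleftrightarrow> v \<in> U - {u}"
    using prescribed_parities[OF w0(1) F(1) F(3), of "U - {u}"] by metis
  have "vc_edge_weighting 2 G w"
    if *: "\<forall>x\<in>nbrs G u. induced_colouring G w x \<noteq> 2 * deg G u"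
  proof -
    have "induced_colouring G w x \<noteq> induced_colouring G w y" if xy: "(x, y) \<in> parcs G" for x y
    proof (cases "x = u \<or> y = u")
      case True
      then show ?thesis using xy * cu[OF w(2)] arc_sym by (metis mem_Collect_eq nbrs_def)
    next
      case False
      have "x \<in> pverts G" "y \<in> pverts G" using xy by (auto dest: in_arcsD1 in_arcsD2)
      moreover have "x \<in> U \<longleftrightarrow> y \<notin> U" using assms(1) xy calculation by (auto simp: splits_def)
      ultimately show ?thesis using w(3)[of x] w(3)[of y] False by auto
    qed
    then show ?thesis using w(1) by (auto simp: vc_edge_weighting_def proper_colouring_def)
  qed
  with w that show thesis by blast
qed

section \<open>Connectedness\<close>

lemma link_leaves:
  assumes "links (uedges G) (pverts G)" "x \<in> S" "S \<subset> pverts G"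
  obtains a b where "(a, b) \<in> parcs G" "a \<in> S" "b \<notin> S"
proof -
  obtain y where y: "y \<in> pverts G" "y \<notin> S" using assms(3) by auto
  then have "(x, y) \<in> {(a, b). {a, b} \<in> uedges G}\<^sup>*"
    using assms by (auto simp: links_def)
  then have "y \<notin> S \<Longrightarrow> \<exists>a b. (a, b) \<in> parcs G \<and> a \<in> S \<and> b \<notin> S"
    by induction (use assms(2) uedges_iff in auto)
  with y that show thesis by blast
qed

text \<open>
  With a third vertex present, some edge leaves the pair, and the end where it starts has the other
  end of the pair as a second neighbour.
\<close>

lemma adjacent_degree_ge_2:
  assumes "links (uedges G) (pverts G)" "card (pverts G) \<ge> 3" "(x, y) \<in> parcs G"
  shows "deg G x \<ge> 2 \<or> deg G y \<ge> 2"
proof -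
  have "{x, y} \<subseteq> pverts G" using assms(3) by (auto dest: in_arcsD1 in_arcsD2)
  moreover have "card {x, y} \<le> 2" by (simp add: card_insert_if)
  with assms(2) have "{x, y} \<noteq> pverts G" by auto
  ultimately obtain a b where ab: "(a, b) \<in> parcs G" "a \<in> {x, y}" "b \<notin> {x, y}"
    using link_leaves[OF assms(1), of x "{x, y}"] by blast
  define c where "c = (if a = x then y else x)"
  have "{b, c} \<subseteq> nbrs G a" using ab assms(3) arc_sym by (auto simp: nbrs_def c_def)
  moreover have "card {b, c} = 2" using ab by (auto simp: c_def)
  ultimately have "deg G a \<ge> 2" by (metis card_mono finite_nbrs)
  with ab(2) show ?thesis by auto
qed

text \<open>
  Take a proper nonempty subset \<open>S\<close> of maximum size whose induced subgraph is connected. Some edge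
  leaves \<open>S\<close>, and adding its outer end \<open>l\<close> keeps connectedness; by maximality \<open>l\<close> was the only
  vertex outside \<open>S\<close>.
\<close>

lemma non_cut_vertex:
  assumes "links (uedges G) (pverts G)" "card (pverts G) \<ge> 2"
  obtains l where "l \<in> pverts G" "links {e \<in> uedges G. l \<notin> e} (pverts G - {l})"
proof -
  define P where "P S \<longleftrightarrow> S \<noteq> {} \<and> S \<subset> pverts G \<and> links {e \<in> uedges G. e \<subseteq> S} S" for S
  obtain x where "x \<in> pverts G" using assms(2) by fastforce
  moreover have "card {x} \<noteq> card (pverts G)" using assms(2) by simp
  moreover from this have "{x} \<noteq> pverts G" by metis
  ultimately have "P {x}" by (auto simp: P_def links_def)
  moreover have "\<forall>S. P S \<longrightarrow> card S < Suc (card (pverts G))"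
    unfolding P_def using psubset_card_mono[OF pair_finite_verts] less_SucI by blast
  ultimately obtain S where S: "P S" "\<And>S'. P S' \<Longrightarrow> card S' \<le> card S"
    by (metis ex_has_greatest_nat)
  obtain y where "y \<in> S" using S by (auto simp: P_def)
  then obtain a l where al: "(a, l) \<in> parcs G" "a \<in> S" "l \<notin> S"
    using link_leaves[OF assms(1)] S by (metis P_def)
  have l: "l \<in> pverts G" using al by (auto dest: in_arcsD2)
  have "links {e \<in> uedges G. e \<subseteq> insert l S} (insert l S)"
  proof (rule links_hub)
    fix v assume "v \<in> insert l S"
    then show "(v, a) \<in> {(a, b). {a, b} \<in> {e \<in> uedges G. e \<subseteq> insert l S}}\<^sup>*"
    proof
      assume "v = l"
      then show ?thesis using al arc_sym uedges_iff by (intro r_into_rtrancl) auto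
    next
      assume "v \<in> S"
      then have "(v, a) \<in> {(a, b). {a, b} \<in> {e \<in> uedges G. e \<subseteq> S}}\<^sup>*"
        using S(1) al(2) by (auto simp: P_def links_def)
      then show ?thesis by (rule rtrancl_mono[THEN subsetD, rotated]) auto
    qed
  qed
  moreover have "finite S" using S(1) finite_subset[OF _ pair_finite_verts] by (auto simp: P_def)
  ultimately have "insert l S = pverts G"
    using S(2)[of "insert l S"] S(1) l al(3) by (auto simp: P_def)
  then have "pverts G - {l} = S" using al(3) by auto
  moreover have "links {e \<in> uedges G. l \<notin> e} S"
    unfolding links_def
  proof (intro ballI)
    fix v v' assume "v \<in> S" "v' \<in> S"
    then have "(v, v') \<in> {(a, b). {a, b} \<in> {e \<in> uedges G. e \<subseteq> S}}\<^sup>*"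
      using S(1) by (auto simp: P_def links_def)
    then show "(v, v') \<in> {(a, b). {a, b} \<in> {e \<in> uedges G. l \<notin> e}}\<^sup>*"
      by (rule rtrancl_mono[THEN subsetD, rotated]) (use al(3) in auto)
  qed
  ultimately show thesis using that l by metis
qed

text \<open>
  A vertex \<open>l\<close> whose removal keeps the graph connected is either a leaf, to be used as \<open>k\<close>, or has
  two neighbours. In the latter case it is used as \<open>h\<close>: any single edge at \<open>l\<close> can be given up,
  since one edge is enough to attach \<open>l\<close> to the rest.
\<close>

lemma leaf_or_dispensable_edge:
  assumes "links (uedges G) (pverts G)" "card (pverts G) \<ge> 3"
  obtains h k R where "deg G h \<ge> 2" "k \<in> nbrs G h" "R \<subseteq> uedges G" "links R (pverts G)"
    "nbrs G k = {h} \<or> {h, k} \<notin> R"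
proof -
  obtain l where l: "l \<in> pverts G" "links {e \<in> uedges G. l \<notin> e} (pverts G - {l})"
    using non_cut_vertex assms by (metis Suc_leD eval_nat_numeral(3))
  have "card {l} \<noteq> card (pverts G)" using assms(2) by simp
  then have "{l} \<noteq> pverts G" by metis
  then obtain k where k: "(l, k) \<in> parcs G"
    using link_leaves[OF assms(1), of l "{l}"] l(1) by blast
  show thesis
  proof (cases "deg G l \<ge> 2")
    case True
    then obtain k' where k': "k' \<in> nbrs G l" "k' \<noteq> k"
      using card_le_Suc0_iff_eq[OF finite_nbrs[of l]] by (metis not_less_eq_eq numeral_2_eq_2)
    have "links (uedges G - {{l, k}}) (pverts G)"
    proof (rule links_hub)
      fix v assume v: "v \<in> pverts G"
      show "(v, k') \<in> {(a, b). {a, b} \<in> uedges G - {{l, k}}}\<^sup>*"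
      proof (cases "v = l")
        case True
        then show ?thesis using k' uedges_iff
          by (intro r_into_rtrancl) (auto simp: nbrs_def doubleton_eq_iff)
      next
        case False
        moreover have "k' \<in> pverts G - {l}"
          using k' pair_no_loops[of "(l, k')"] by (auto simp: nbrs_def dest: in_arcsD2)
        ultimately have "(v, k') \<in> {(a, b). {a, b} \<in> {e \<in> uedges G. l \<notin> e}}\<^sup>*"
          using l(2) v by (auto simp: links_def)
        then show ?thesis by (rule rtrancl_mono[THEN subsetD, rotated]) auto
      qed
    qed
    with True k that[of l k "uedges G - {{l, k}}"] show thesis by (auto simp: nbrs_def)
  next
    case False
    have "nbrs G l = {k}"
      using False k finite_nbrs[of l] card_le_Suc0_iff_eq[of "nbrs G l"]
      by (auto simp: nbrs_def)
    moreover have "deg G k \<ge> 2" using adjacent_degree_ge_2[OF assms k] False by simp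
    moreover have "l \<in> nbrs G k" using k arc_sym by (auto simp: nbrs_def)
    ultimately show thesis using that[of k l "uedges G"] assms(1) by auto
  qed
qed

end

section \<open>Cartesian products\<close>

lemma link_map:
  assumes "(x, y) \<in> {(a, b). {a, b} \<in> F}\<^sup>*" "\<And>a b. {a, b} \<in> F \<Longrightarrow> {f a, f b} \<in> F'"
  shows "(f x, f y) \<in> {(a, b). {a, b} \<in> F'}\<^sup>*"
  using assms(1) by induction (auto intro: rtrancl.rtrancl_into_rtrancl assms(2))

lemma pverts_product: "pverts (G \<box> H) = pverts G \<times> pverts H"
  by (simp add: cartesian_product_def)

lemma arc_product_iff: "((x, y), (x', y')) \<in> parcs (G \<box> H) \<longleftrightarrow>
    x = x' \<and> x \<in> pverts G \<and> (y, y') \<in> parcs H \<or> y = y' \<and> y \<in> pverts H \<and> (x, x') \<in> parcs G"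
  by (auto simp: cartesian_product_def)

lemma nbrs_product:
  assumes "x \<in> pverts G" "y \<in> pverts H"
  shows "nbrs (G \<box> H) (x, y) = {x} \<times> nbrs H y \<union> nbrs G x \<times> {y}"
  using assms by (auto simp: nbrs_def arc_product_iff)

lemma splits_product:
  assumes "pair_graph G" "pair_graph H" "splits G A B" "splits H C D"
  shows "splits (G \<box> H) (A \<times> C \<union> B \<times> D) (A \<times> D \<union> B \<times> C)"
proof -
  interpret G: pair_graph G by fact
  interpret H: pair_graph H by fact
  have "x \<in> A \<longleftrightarrow> y \<in> B" "x \<in> B \<longleftrightarrow> y \<in> A" if "(x, y) \<in> parcs G" for x y
    using that assms(3) G.splits_sym[OF assms(3)] by (auto simp: splits_def)
  moreover have "x \<in> C \<longleftrightarrow> y \<in> D" "x \<in> D \<longleftrightarrow> y \<in> C" if "(x, y) \<in> parcs H" for x y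
    using that assms(4) H.splits_sym[OF assms(4)] by (auto simp: splits_def)
  ultimately have "z \<in> A \<times> C \<union> B \<times> D \<longleftrightarrow> z' \<in> A \<times> D \<union> B \<times> C"
    if "(z, z') \<in> parcs (G \<box> H)" for z z'
    using that by (cases z; cases z') (auto simp: arc_product_iff)
  moreover have "(A \<times> C \<union> B \<times> D) \<union> (A \<times> D \<union> B \<times> C) = pverts G \<times> pverts H"
    using assms(3,4) by (auto simp: splits_def)
  moreover have "(A \<times> C \<union> B \<times> D) \<inter> (A \<times> D \<union> B \<times> C) = {}"
    using assms(3,4) by (auto simp: splits_def)
  ultimately show ?thesis by (simp add: splits_def pverts_product)
qed

lemma deg_product:
  assumes "pair_graph G" "pair_graph H" "x \<in> pverts G" "y \<in> pverts H"
  shows "deg (G \<box> H) (x, y) = deg G x + deg H y"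
proof -
  interpret G: pair_graph G by fact
  interpret H: pair_graph H by fact
  have "({x} \<times> nbrs H y) \<inter> (nbrs G x \<times> {y}) = {}"
    using G.pair_no_loops[of "(x, x)"] by (auto simp: nbrs_def)
  then show ?thesis
    using assms(3,4)
    by (simp add: nbrs_product card_Un_disjoint G.finite_nbrs H.finite_nbrs card_cartesian_product_singleton
        card_cartesian_product)
qed

section \<open>Two factors with at least three vertices\<close>

lemma maximum_degree_vertex:
  assumes "pair_graph G" "links (uedges G) (pverts G)" "card (pverts G) \<ge> 3"
  obtains g where "g \<in> pverts G" "deg G g \<ge> 2" "\<And>x. deg G x \<le> deg G g"
proof -
  interpret pair_graph G by fact
  have nz: "deg G x = 0" if "x \<notin> pverts G" for x
  proof -
    have "nbrs G x = {}" using that by (auto simp: nbrs_def dest: in_arcsD1)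
    then show ?thesis by simp
  qed
  obtain h where h: "deg G h \<ge> 2"
    using leaf_or_dispensable_edge[OF assms(2,3)] by metis
  then have "h \<in> pverts G" using nz by fastforce
  then have "Max (deg G ` pverts G) \<in> deg G ` pverts G"
    using pair_finite_verts by (intro Max_in) auto
  then obtain g where g: "g \<in> pverts G" "deg G g = Max (deg G ` pverts G)" by auto
  then have le: "deg G x \<le> deg G g" for x
    using nz[of x] pair_finite_verts by (cases "x \<in> pverts G") auto
  with g h that[of g] show thesis by (meson order_trans)
qed

text \<open>
  The degree of \<open>(x, y)\<close> is the sum of the degrees of \<open>x\<close> and \<open>y\<close>, so \<open>(g, h)\<close> has maximum degree
  in the product. A neighbour in its row or column with a second neighbour in the same line meets
  an edge of fixed weight \<open>1\<close>; without one it has degree \<open>1\<close> along that line, where \<open>(g, h)\<close> has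
  degree at least \<open>2\<close>.
\<close>

lemma product_weighting_ge_3:
  assumes G: "pair_graph G" "links (uedges G) (pverts G)" "card (pverts G) \<ge> 3"
    and H: "pair_graph H" "links (uedges H) (pverts H)" "card (pverts H) \<ge> 3"
    and UW: "splits (G \<box> H) U W" "odd (card U)" "odd (card W)"
  shows "\<exists>w. vc_edge_weighting 2 (G \<box> H) w"
proof -
  interpret G: pair_graph G by fact
  interpret H: pair_graph H by fact
  interpret P: pair_graph "G \<box> H" using G(1) H(1) by (rule pair_graph_cartesian_product)
  obtain g where g: "g \<in> pverts G" "deg G g \<ge> 2" "\<And>x. deg G x \<le> deg G g"
    using maximum_degree_vertex[OF G] by metis
  obtain h where h: "h \<in> pverts H" "deg H h \<ge> 2" "\<And>x. deg H x \<le> deg H h"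
    using maximum_degree_vertex[OF H] by metis
  have "(g, h) \<in> U \<or> (g, h) \<in> W" using UW(1) g(1) h(1) by (auto simp: splits_def pverts_product)
  then obtain U' W' where U': "splits (G \<box> H) U' W'" "odd (card U')" "(g, h) \<in> U'"
    using UW P.splits_sym by metis
  define F where "F = {e \<in> uedges (G \<box> H). \<not> e \<subseteq> UNIV \<times> {h} \<and> \<not> e \<subseteq> {g} \<times> UNIV}"
  define w0 :: "('a \<times> 'b) set \<Rightarrow> nat" where "w0 e = (if (g, h) \<in> e then 2 else 1)" for e
  have "pverts G \<noteq> {g}" using G(3) by auto
  then obtain x0 where x0: "x0 \<in> pverts G" "x0 \<noteq> g"
    using g(1) by blast
  have "pverts H \<noteq> {h}" using H(3) by auto
  then obtain y0 where y0: "y0 \<in> pverts H" "y0 \<noteq> h"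
    using h(1) by blast
  have row: "((a, y), (b, y)) \<in> {(a, b). {a, b} \<in> F}\<^sup>*"
    if "a \<in> pverts G" "b \<in> pverts G" "y \<in> pverts H" "y \<noteq> h" for a b y
  proof (rule link_map[where f = "\<lambda>a. (a, y)"])
    show "(a, b) \<in> {(a, b). {a, b} \<in> uedges G}\<^sup>*" using G(2) that by (auto simp: links_def)
    show "{(a, y), (b, y)} \<in> F" if "{a, b} \<in> uedges G" for a b
      using that \<open>y \<in> _\<close> \<open>y \<noteq> h\<close> G.pair_no_loops[of "(g, g)"]
      by (auto simp: F_def P.uedges_iff G.uedges_iff arc_product_iff)
  qed
  have column: "((x, a), (x, b)) \<in> {(a, b). {a, b} \<in> F}\<^sup>*"
    if "a \<in> pverts H" "b \<in> pverts H" "x \<in> pverts G" "x \<noteq> g" for a b x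
  proof (rule link_map[where f = "\<lambda>a. (x, a)"])
    show "(a, b) \<in> {(a, b). {a, b} \<in> uedges H}\<^sup>*" using H(2) that by (auto simp: links_def)
    show "{(x, a), (x, b)} \<in> F" if "{a, b} \<in> uedges H" for a b
      using that \<open>x \<in> _\<close> \<open>x \<noteq> g\<close> H.pair_no_loops[of "(h, h)"]
      by (auto simp: F_def P.uedges_iff H.uedges_iff arc_product_iff)
  qed
  \<comment> \<open>A vertex of column \<open>g\<close> first moves along its row to column \<open>x0\<close>, any other vertex first moves
      along its column to row \<open>y0\<close>; neither step uses an edge of row \<open>h\<close> or column \<open>g\<close>.\<close>
  have "links F (pverts (G \<box> H) - {(g, h)})"
  proof (rule links_hub)
    fix z assume "z \<in> pverts (G \<box> H) - {(g, h)}"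
    then obtain x y where z: "z = (x, y)" "x \<in> pverts G" "y \<in> pverts H" "x \<noteq> g \<or> y \<noteq> h"
      by (auto simp: pverts_product)
    show "(z, (x0, y0)) \<in> {(a, b). {a, b} \<in> F}\<^sup>*"
    proof (cases "x = g")
      case True
      then show ?thesis
        using row[of x x0 y] column[of y y0 x0] z x0 y0 by (auto intro: rtrancl_trans)
    next
      case False
      then show ?thesis
        using column[of y y0 x] row[of x x0 y0] z x0 y0 by (auto intro: rtrancl_trans)
    qed
  qed
  moreover have "F \<subseteq> uedges (G \<box> H)" by (auto simp: F_def)
  moreover have "(g, h) \<notin> e" if "e \<in> F" for e
    using that by (auto simp: F_def uedges_def arc_product_iff)
  moreover have "edge_weighting 2 (G \<box> H) w0" by (auto simp: w0_def edge_weighting_def)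
  moreover have "w0 {(g, h), y} = 2" for y by (simp add: w0_def)
  ultimately obtain w where w: "edge_weighting 2 (G \<box> H) w" "\<And>e. e \<notin> F \<Longrightarrow> w e = w0 e"
    "\<forall>z\<in>nbrs (G \<box> H) (g, h). induced_colouring (G \<box> H) w z \<noteq> 2 * deg (G \<box> H) (g, h)
      \<Longrightarrow> vc_edge_weighting 2 (G \<box> H) w"
    using P.one_exceptional_vertex[OF U'] by metis
  have "induced_colouring (G \<box> H) w z < 2 * deg (G \<box> H) (g, h)"
    if z: "z \<in> nbrs (G \<box> H) (g, h)" for z
  proof -
    obtain x y where xy: "z = (x, y)" by (cases z)
    have V: "x \<in> pverts G" "y \<in> pverts H"
      using z xy P.in_arcsD2[of "(g, h)" z] by (auto simp: nbrs_def pverts_product)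
    have le: "deg G x + deg H y \<le> deg G g + deg H h" using g(3) h(3) by (simp add: add_mono)
    note bound = P.induced_colouring_le[OF w(1), of z]
    from z xy consider "x = g" "(h, y) \<in> parcs H" | "y = h" "(g, x) \<in> parcs G"
      by (auto simp: nbrs_def arc_product_iff)
    then show ?thesis
    proof cases
      case 1
      show ?thesis
      proof (cases "deg H y \<ge> 2")
        case True
        then obtain y' where y': "y' \<in> nbrs H y" "y' \<noteq> h"
          using card_le_Suc0_iff_eq[OF H.finite_nbrs[of y]] by (metis not_less_eq_eq numeral_2_eq_2)
        have "y \<noteq> h" using 1 H.pair_no_loops[of "(h, h)"] by auto
        then have "w {z, (g, y')} = 1" using y' xy 1 w(2) by (auto simp: F_def w0_def)
        moreover have "(g, y') \<in> nbrs (G \<box> H) z" using y' xy 1 V by (auto simp: nbrs_product)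
        ultimately show ?thesis
          using P.induced_colouring_less[OF w(1)] le xy V g(1) h(1)
          by (metis deg_product[OF G(1) H(1)] mult_le_mono2 order_less_le_trans)
      next
        case False
        then show ?thesis using bound 1 xy V h g(1) by (simp add: deg_product[OF G(1) H(1)])
      qed
    next
      case 2
      show ?thesis
      proof (cases "deg G x \<ge> 2")
        case True
        then obtain x' where x': "x' \<in> nbrs G x" "x' \<noteq> g"
          using card_le_Suc0_iff_eq[OF G.finite_nbrs[of x]] by (metis not_less_eq_eq numeral_2_eq_2)
        have "x \<noteq> g" using 2 G.pair_no_loops[of "(g, g)"] by auto
        then have "w {z, (x', h)} = 1" using x' xy 2 w(2) by (auto simp: F_def w0_def)
        moreover have "(x', h) \<in> nbrs (G \<box> H) z" using x' xy 2 V by (auto simp: nbrs_product)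
        ultimately show ?thesis
          using P.induced_colouring_less[OF w(1)] le xy V g(1) h(1)
          by (metis deg_product[OF G(1) H(1)] mult_le_mono2 order_less_le_trans)
      next
        case False
        then show ?thesis using bound 2 xy V g h(1) by (simp add: deg_product[OF G(1) H(1)])
      qed
    qed
  qed
  then have "vc_edge_weighting 2 (G \<box> H) w" by (intro w(3) ballI less_imp_neq)
  then show ?thesis by blast
qed

section \<open>A single edge as a factor\<close>

text \<open>
  The exceptional vertex is \<open>(p, h)\<close>, with colour \<open>2 * (deg H h + 1)\<close>. All edges in the layer of
  \<open>p\<close> are fixed, and parities are adjusted with the edges \<open>R\<close> in the layer of \<open>q\<close> and the vertical
  edges other than the one at \<open>h\<close>. At a neighbour \<open>(p, a)\<close> of the exceptional vertex the weight of
  the vertical edge is determined by the parity of the colour, so the colour depends only on the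
  common weight \<open>b a\<close> of the layer edges from \<open>(p, a)\<close> that do not lead to \<open>(p, h)\<close>.
\<close>

lemma prism_weighting:
  assumes G: "pair_graph G" "pverts G = {p, q}" "(p, q) \<in> parcs G"
    and H: "pair_graph H" "splits H C D"
    and UW: "splits (G \<box> H) U W" "odd (card U)" "(p, h) \<in> U"
    and h: "deg H h \<ge> 2" and R: "R \<subseteq> uedges H" "links R (pverts H)"
    and k: "k \<in> nbrs H h" "nbrs H k = {h} \<or> {h, k} \<notin> R"
  shows "\<exists>w. vc_edge_weighting 2 (G \<box> H) w"
proof -
  interpret G: pair_graph G by fact
  interpret H: pair_graph H by fact
  interpret P: pair_graph "G \<box> H" using G(1) H(1) by (rule pair_graph_cartesian_product)
  have "p \<noteq> q" using G(3) G.pair_no_loops by fastforce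
  have nG: "nbrs G p = {q}" "nbrs G q = {p}"
  proof -
    have "x \<in> {p, q} \<and> x \<noteq> a" if "(a, x) \<in> parcs G" for a x
      using that G(2) G.in_arcsD2[OF that] G.pair_no_loops[OF that] by auto
    then show "nbrs G p = {q}" "nbrs G q = {p}"
      using G(3) G.arc_sym[of p q] unfolding nbrs_def by blast+
  qed
  have hV: "h \<in> pverts H" using k(1) by (auto simp: nbrs_def dest: H.in_arcsD1)
  let ?c = "induced_colouring (G \<box> H)"
  \<comment> \<open>With \<open>b a = 2\<close> the even colour of \<open>(p, a)\<close> must be \<open>2 * (deg H a + 1)\<close>, which is wrong only
      if \<open>a\<close> and \<open>h\<close> have equal degree \<open>d\<close>; in that case \<open>b a = 1\<close> keeps the colour at most
      \<open>d + 3 < 2 * (d + 1)\<close>.\<close>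
  define b :: "'b \<Rightarrow> nat" where "b a = (if deg H a = deg H h then 1 else 2)" for a
  define w0 where "w0 e = (if (p, h) \<in> e \<or> (\<exists>a \<in> nbrs H h. (p, a) \<in> e \<and> b a = 2) then 2 else 1::nat)"
    for e
  define F where "F = (`) (Pair q) ` R \<union> {{(p, a), (q, a)} | a. a \<in> pverts H \<and> a \<noteq> h}"
  have F_links: "links F (pverts (G \<box> H) - {(p, h)})"
  proof (rule links_hub)
    fix z assume "z \<in> pverts (G \<box> H) - {(p, h)}"
    then obtain x a where z: "z = (x, a)" "x = q \<or> x = p \<and> a \<noteq> h" "a \<in> pverts H"
      by (auto simp: pverts_product G(2))
    have "((q, a), (q, h)) \<in> {(a, b). {a, b} \<in> F}\<^sup>*"
    proof (rule link_map[where f = "Pair q"])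
      show "(a, h) \<in> {(a, b). {a, b} \<in> R}\<^sup>*" using R(2) z(3) hV by (auto simp: links_def)
      show "{(q, a), (q, b)} \<in> F" if "{a, b} \<in> R" for a b
        using imageI[OF that, of "(`) (Pair q)"] by (auto simp: F_def)
    qed
    moreover have "{(p, a), (q, a)} \<in> F" if "a \<noteq> h"
      using z(3) that by (auto simp: F_def)
    ultimately show "(z, (q, h)) \<in> {(a, b). {a, b} \<in> F}\<^sup>*"
      using z by (auto intro: converse_rtrancl_into_rtrancl)
  qed
  have F_sub: "F \<subseteq> uedges (G \<box> H)"
  proof -
    have "Pair q ` e \<in> uedges (G \<box> H)" if "e \<in> R" for e
    proof -
      obtain a b where ab: "e = {a, b}" "(a, b) \<in> parcs H" using \<open>e \<in> R\<close> R(1) by (auto simp: uedges_def)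
      then have "((q, a), (q, b)) \<in> parcs (G \<box> H)" using G(2) by (simp add: arc_product_iff)
      then show ?thesis using ab(1) P.uedges_iff by simp
    qed
    moreover have "{(p, a), (q, a)} \<in> uedges (G \<box> H)" if "a \<in> pverts H" for a
      using that G(3) by (auto simp: P.uedges_iff arc_product_iff)
    ultimately show ?thesis by (auto simp: F_def)
  qed
  have F_u: "(p, h) \<notin> e" if "e \<in> F" for e
    using that \<open>p \<noteq> q\<close> by (auto simp: F_def)
  have w0: "edge_weighting 2 (G \<box> H) w0" by (auto simp: w0_def edge_weighting_def)
  have w0_u: "w0 {(p, h), y} = 2" for y by (simp add: w0_def)
  obtain w where w: "edge_weighting 2 (G \<box> H) w" "\<And>e. e \<notin> F \<Longrightarrow> w e = w0 e"
    "\<And>v. v \<in> pverts (G \<box> H) \<Longrightarrow> odd (?c w v) \<longleftrightarrow> v \<in> U - {(p, h)}"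
    "\<forall>z\<in>nbrs (G \<box> H) (p, h). ?c w z \<noteq> 2 * deg (G \<box> H) (p, h)
      \<Longrightarrow> vc_edge_weighting 2 (G \<box> H) w"
    using P.one_exceptional_vertex[OF UW F_sub F_u F_links w0 w0_u] by blast
  have deg_u: "deg (G \<box> H) (p, h) = deg H h + 1" "deg (G \<box> H) (q, h) = deg H h + 1"
    using G(2) hV by (simp_all add: deg_product[OF G(1) H(1)] nG)
  have nP: "nbrs (G \<box> H) (p, a) = insert (q, a) (Pair p ` nbrs H a)"
    "nbrs (G \<box> H) (q, a) = insert (p, a) (Pair q ` nbrs H a)" if "a \<in> pverts H" for a
    using that G(2) by (auto simp: nbrs_product nG)
  have U_alt: "z \<in> U \<longleftrightarrow> z' \<notin> U" if "(z, z') \<in> parcs (G \<box> H)" for z z'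
    using UW(1) that P.in_arcsD2[OF that] unfolding splits_def by blast
  have even_nbr: "even (?c w z)" if "z \<in> nbrs (G \<box> H) (p, h)" for z
    using that w(3)[of z] U_alt[of "(p, h)" z] UW(3) P.in_arcsD2[of "(p, h)" z] by (auto simp: nbrs_def)
  have cp: "?c w (p, a) = w {(p, a), (q, a)} + (2 + (deg H a - 1) * b a)" if a: "a \<in> nbrs H h" for a
  proof -
    have aV: "a \<in> pverts H" and ha: "h \<in> nbrs H a" and "a \<noteq> h"
      using a H.arc_sym[of h a] H.pair_no_loops[of "(h, h)"] by (auto simp: nbrs_def dest: H.in_arcsD2)
    have "w {(p, a), (p, y)} = b a" if "y \<in> nbrs H a - {h}" for y
    proof -
      \<comment> \<open>A bipartite graph has no triangles, so \<open>b a\<close> and \<open>b y\<close> do not compete for this edge.\<close>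
      have "y \<notin> nbrs H h"
        using a that H(2) H.splits_sym[OF H(2)] H.in_arcsD1[of h a]
        unfolding nbrs_def splits_def by blast
      moreover have "{(p, a), (p, y)} \<notin> F" using \<open>p \<noteq> q\<close> by (auto simp: F_def doubleton_eq_iff)
      ultimately show ?thesis using w(2) a that \<open>a \<noteq> h\<close> by (auto simp: w0_def b_def)
    qed
    moreover have "w {(p, a), (p, h)} = 2"
    proof -
      have "{(p, a), (p, h)} \<notin> F" using \<open>p \<noteq> q\<close> by (auto simp: F_def doubleton_eq_iff)
      then show ?thesis using w(2) by (simp add: w0_def)
    qed
    ultimately have "(\<Sum>y\<in>nbrs H a. w {(p, a), (p, y)}) = 2 + (deg H a - 1) * b a"
      using ha by (simp add: sum.remove[OF H.finite_nbrs ha] card_Diff_singleton)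
    moreover have "?c w (p, a) = w {(p, a), (q, a)} + (\<Sum>y\<in>nbrs H a. w {(p, a), (p, y)})"
      unfolding P.induced_colouring_nbrs nP(1)[OF aV]
      using \<open>p \<noteq> q\<close> by (subst sum.insert) (auto simp: H.finite_nbrs sum.reindex inj_on_def)
    ultimately show ?thesis by simp
  qed
  have vert: "w {(p, a), (q, a)} = 1 \<or> w {(p, a), (q, a)} = 2" if "a \<in> pverts H" for a
    using P.weight_1_or_2[OF w(1), of "(q, a)" "(p, a)"] nP(1)[OF that] by auto
  have "?c w (p, a) \<noteq> 2 * (deg H h + 1)" if a: "a \<in> nbrs H h" for a
  proof -
    have aV: "a \<in> pverts H" using a by (auto simp: nbrs_def dest: H.in_arcsD2)
    have ev: "even (?c w (p, a))" using even_nbr a nP(1)[OF hV] by auto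
    have pos: "deg H a > 0"
      using a H.arc_sym[of h a] H.finite_nbrs[of a] by (auto simp: card_gt_0_iff nbrs_def)
    show ?thesis
    proof (cases "deg H a = deg H h")
      case True
      then show ?thesis using cp[OF a] vert[OF aV] h by (auto simp: b_def)
    next
      case False
      then have "?c w (p, a) = w {(p, a), (q, a)} + 2 * deg H a"
        using cp[OF a] pos by (cases "deg H a") (auto simp: b_def)
      with ev vert[OF aV] have "?c w (p, a) = 2 * (deg H a + 1)" by auto
      with False show ?thesis by simp
    qed
  qed
  moreover have "?c w (q, h) < 2 * (deg H h + 1)"
  proof -
    have kV: "k \<in> pverts H" and "k \<noteq> h"
      using k H.pair_no_loops[of "(h, h)"] by (auto simp: nbrs_def dest: H.in_arcsD2)
    have "w {(q, h), (q, k)} = 1"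
    proof (cases "{h, k} \<in> R")
      case False
      have "{(q, h), (q, k)} \<notin> F"
      proof
        assume "{(q, h), (q, k)} \<in> F"
        then obtain e where e: "e \<in> R" "Pair q ` e = Pair q ` {h, k}"
          using \<open>p \<noteq> q\<close> by (auto simp: F_def doubleton_eq_iff)
        have "inj (Pair q)" by (simp add: inj_on_def)
        then have "e = {h, k}" using e(2) by (metis inj_image_eq_iff)
        with e(1) False show False by simp
      qed
      then show ?thesis using w(2) \<open>p \<noteq> q\<close> by (auto simp: w0_def)
    next
      case True
      then have nk: "nbrs H k = {h}" using k by simp
      \<comment> \<open>The vertices \<open>(p, k)\<close> and \<open>(q, k)\<close> have degree \<open>2\<close>. The first is even and has an edge of
          weight \<open>2\<close> to \<open>(p, h)\<close>, so the vertical edge has weight \<open>2\<close>; the second is odd, so its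
          other edge has weight \<open>1\<close>.\<close>
      have "even (?c w (p, k))" using even_nbr k nP(1)[OF hV] by auto
      then have v: "w {(p, k), (q, k)} = 2" using cp[OF k(1)] vert[OF kV] nk by auto
      have "((q, h), (q, k)) \<in> parcs (G \<box> H)" "((p, h), (q, h)) \<in> parcs (G \<box> H)"
        using k(1) hV G(2,3) by (auto simp: arc_product_iff nbrs_def)
      then have "(q, k) \<in> U" using U_alt UW(3) by blast
      then have "odd (?c w (q, k))" using w(3)[of "(q, k)"] kV G(2) \<open>p \<noteq> q\<close> by (simp add: pverts_product)
      moreover have "?c w (q, k) = w {(p, k), (q, k)} + w {(q, h), (q, k)}"
        unfolding P.induced_colouring_nbrs nP(2)[OF kV] nk
        using \<open>p \<noteq> q\<close> by (simp add: insert_commute)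
      moreover have "w {(q, h), (q, k)} = 1 \<or> w {(q, h), (q, k)} = 2"
        using P.weight_1_or_2[OF w(1), of "(q, k)" "(q, h)"] nP(2)[OF hV] k by auto
      ultimately show ?thesis using v by auto
    qed
    moreover have "(q, k) \<in> nbrs (G \<box> H) (q, h)" using nP(2)[OF hV] k by auto
    ultimately show ?thesis using P.induced_colouring_less[OF w(1)] deg_u by metis
  qed
  ultimately have "vc_edge_weighting 2 (G \<box> H) w"
    using w(4) nP(1)[OF hV] deg_u by auto
  then show ?thesis by blast
qed

lemma product_weighting_card_2:
  assumes G: "pair_graph G" "links (uedges G) (pverts G)" "card (pverts G) = 2"
    and H: "pair_graph H" "links (uedges H) (pverts H)" "card (pverts H) \<ge> 2" "splits H C D"
    and UW: "splits (G \<box> H) U W" "odd (card U)" "odd (card W)"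
  shows "\<exists>w. vc_edge_weighting 2 (G \<box> H) w"
proof -
  interpret G: pair_graph G by fact
  interpret H: pair_graph H by fact
  interpret P: pair_graph "G \<box> H" using G(1) H(1) by (rule pair_graph_cartesian_product)
  obtain p q where pq: "pverts G = {p, q}" "p \<noteq> q" using G(3) by (auto simp: card_2_iff)
  then have arc: "(p, q) \<in> parcs G"
    using G.link_leaves[OF G(2), of p "{p}"] by (auto dest: G.in_arcsD2)
  have "((p, a), (q, a)) \<in> parcs (G \<box> H)" if "a \<in> pverts H" for a
    using that arc by (simp add: arc_product_iff)
  then have UWpq: "(p, a) \<in> U \<longleftrightarrow> (q, a) \<in> W" if "a \<in> pverts H" for a
    using that UW(1) by (auto simp: splits_def)
  have UWV: "U \<union> W = {p, q} \<times> pverts H" "U \<inter> W = {}" using UW(1) pq(1) by (auto simp: splits_def pverts_product)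
  show ?thesis
  proof (cases "card (pverts H) = 2")
    case True
    \<comment> \<open>Each vertical edge has exactly one end in \<open>U\<close>, so \<open>U\<close> has as many elements as \<open>H\<close> has
        vertices.\<close>
    have mem: "\<And>x a. (x, a) \<in> U \<Longrightarrow> (x = p \<or> x = q) \<and> a \<in> pverts H"
      using UWV(1) by blast
    have one: "(p, a) \<in> U \<longleftrightarrow> (q, a) \<notin> U" if "a \<in> pverts H" for a
      using UWpq[OF that] UWV that by blast
    have "inj_on snd U"
      using mem one by (intro inj_onI) (metis prod.collapse)
    moreover have "snd ` U = pverts H"
      using mem one by force
    ultimately have "card U = 2" using True card_image by metis
    with UW(2) show ?thesis by simp
  next
    case False
    then have "card (pverts H) \<ge> 3" using H(3) by simp
    from H.leaf_or_dispensable_edge[OF H(2) this] obtain h k R where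
      hk: "deg H h \<ge> 2" "R \<subseteq> uedges H" "links R (pverts H)" "k \<in> nbrs H h" "nbrs H k = {h} \<or> {h, k} \<notin> R"
      by metis
    have "h \<in> pverts H" using hk(4) by (auto simp: nbrs_def dest: H.in_arcsD1)
    then have "(p, h) \<in> U \<or> (p, h) \<in> W" using UWV by auto
    then obtain U' W' where "splits (G \<box> H) U' W'" "odd (card U')" "(p, h) \<in> U'"
      using UW P.splits_sym by metis
    from prism_weighting[OF G(1) pq(1) arc H(1,4) this hk] show ?thesis .
  qed
qed

section \<open>Arbitrary connected bipartite factors\<close>

lemma nbrs_product_swap: "nbrs (H \<box> G) (prod.swap z) = prod.swap ` nbrs (G \<box> H) z"
proof (cases z)
  case (Pair x y)
  have "z' \<in> nbrs (H \<box> G) (y, x) \<longleftrightarrow> prod.swap z' \<in> nbrs (G \<box> H) (x, y)" for z'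
    by (cases z') (auto simp: nbrs_def arc_product_iff)
  then show ?thesis using Pair by (auto simp: image_iff) (metis swap_simp)+
qed

lemma product_weighting_swap:
  assumes "pair_graph G" "pair_graph H" "vc_edge_weighting 2 (H \<box> G) w"
  shows "vc_edge_weighting 2 (G \<box> H) (\<lambda>e. w (prod.swap ` e))"
proof -
  interpret P: pair_graph "G \<box> H" using assms(1,2) by (rule pair_graph_cartesian_product)
  interpret Q: pair_graph "H \<box> G" using assms(2,1) by (rule pair_graph_cartesian_product)
  have arcs: "(prod.swap z, prod.swap z') \<in> parcs (H \<box> G)" if "(z, z') \<in> parcs (G \<box> H)" for z z'
    using that by (cases z; cases z') (auto simp: arc_product_iff)
  have "induced_colouring (G \<box> H) (\<lambda>e. w (prod.swap ` e)) z = induced_colouring (H \<box> G) w (prod.swap z)" for z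
    unfolding P.induced_colouring_nbrs Q.induced_colouring_nbrs nbrs_product_swap
    by (subst sum.reindex) (auto simp: inj_on_def)
  moreover have "prod.swap ` e \<in> uedges (H \<box> G)" if "e \<in> uedges (G \<box> H)" for e
    using that arcs by (fastforce simp: uedges_def)
  ultimately show ?thesis
    using assms(3) arcs unfolding vc_edge_weighting_def edge_weighting_def proper_colouring_def by fastforce
qed

lemma links_product:
  assumes "pair_graph G" "links (uedges G) (pverts G)" "pair_graph H" "links (uedges H) (pverts H)"
  shows "links (uedges (G \<box> H)) (pverts (G \<box> H))"
proof -
  interpret G: pair_graph G by fact
  interpret H: pair_graph H by fact
  interpret P: pair_graph "G \<box> H" using assms(1,3) by (rule pair_graph_cartesian_product)
  have row: "((x, y), (x', y)) \<in> {(a, b). {a, b} \<in> uedges (G \<box> H)}\<^sup>*"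
    if "x \<in> pverts G" "x' \<in> pverts G" "y \<in> pverts H" for x x' y
    using that assms(2)
    by (intro link_map[where f = "\<lambda>a. (a, y)" and F = "uedges G"])
       (auto simp: links_def G.uedges_iff P.uedges_iff arc_product_iff)
  have column: "((x, y), (x, y')) \<in> {(a, b). {a, b} \<in> uedges (G \<box> H)}\<^sup>*"
    if "x \<in> pverts G" "y \<in> pverts H" "y' \<in> pverts H" for x y y'
    using that assms(4)
    by (intro link_map[where f = "\<lambda>a. (x, a)" and F = "uedges H"])
       (auto simp: links_def H.uedges_iff P.uedges_iff arc_product_iff)
  show ?thesis
    unfolding links_def pverts_product
    by clarify (rule rtrancl_trans[OF row column])
qed

theorem theorem2p4:
  fixes G :: "'a pair_pre_digraph" and H :: "'b pair_pre_digraph"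
  assumes "pair_graph G" and "connected G" and "bipartite G" and "card (pverts G) \<ge> 2"
    and "pair_graph H" and "connected H" and "bipartite H" and "card (pverts H) \<ge> 2"
    and "\<not> K\<^bsub>2\<^esub> (G \<box> H)"
  shows "\<mu> (G \<box> H) \<le> 2"
proof -
  interpret P: pair_graph "G \<box> H" using assms(1,5) by (rule pair_graph_cartesian_product)
  have G: "links (uedges G) (pverts G)" and H: "links (uedges H) (pverts H)"
    using pair_graph.connected_links assms by blast+
  obtain A B where AB: "splits G A B" using assms bipartite_splits by blast
  obtain C D where CD: "splits H C D" using assms bipartite_splits by blast
  note UW = splits_product[OF assms(1,5) AB CD]
  note UW' = splits_product[OF assms(5,1) CD AB]
  have "\<exists>w. vc_edge_weighting 2 (G \<box> H) w"
  proof (cases "even (card (A \<times> C \<union> B \<times> D)) \<or> even (card (A \<times> D \<union> B \<times> C))")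
    case True
    then show ?thesis
      using P.vc_edge_weighting_even_part[OF UW] P.vc_edge_weighting_even_part[OF P.splits_sym[OF UW]]
        links_product[OF assms(1) G assms(5) H] by blast
  next
    case False
    then have odd: "odd (card (A \<times> C \<union> B \<times> D))" "odd (card (A \<times> D \<union> B \<times> C))" by auto
    consider "card (pverts G) = 2" | "card (pverts H) = 2" | "card (pverts G) \<ge> 3" "card (pverts H) \<ge> 3"
      using assms(4,8) by linarith
    then show ?thesis
    proof cases
      case 1
      then show ?thesis using product_weighting_card_2[OF assms(1) G _ assms(5) H assms(8) CD UW odd] by simp
    next
      case 2
      have "C \<times> A \<union> D \<times> B = prod.swap ` (A \<times> C \<union> B \<times> D)" "C \<times> B \<union> D \<times> A = prod.swap ` (A \<times> D \<union> B \<times> C)"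
        by auto
      then have "odd (card (C \<times> A \<union> D \<times> B))" "odd (card (C \<times> B \<union> D \<times> A))"
        using odd by (simp_all add: card_image)
      from product_weighting_card_2[OF assms(5) H 2 assms(1) G assms(4) AB UW' this]
      show ?thesis using product_weighting_swap[OF assms(1,5)] by blast
    next
      case 3
      then show ?thesis using product_weighting_ge_3[OF assms(1) G _ assms(5) H _ UW odd] by simp
    qed
  qed
  then have "enat 2 \<in> {enat k | k. k \<ge> 1 \<and> (\<exists>w. vc_edge_weighting k (G \<box> H) w)}"
    by force
  then have "\<mu> (G \<box> H) \<le> enat 2" unfolding mu_def by (rule Inf_lower)
  then show ?thesis by (simp add: numeral_eq_enat)
qed

end
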